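(* Assume (A1) $\mathbb{E}\log\rho_0=0$ and (A2) there is $\delta_0\in(0,1)$ with $\mathbb{P}(\delta_0\le\omega(0)\le 1-\delta_0)=1$, and $\mathrm{Var}(\log\rho_0)>0$. Then the probability measure $\mathbb{Q}$ is invariant and reversible for the Markov chain on $\Omega$ of the environment seen from the particle, i.e. the Markov chain with transition kernel $R$. Moreover, the measures $\mathbb{P}$ and $\mathbb{Q}$ on $\Omega$ are mutually singular.
   Context: $\Omega=[0,1]^{\mathbb{Z}}$ with the distance $d(\omega,\omega')=\sum_{x\in\mathbb{Z}}2^{-|x|}|\omega(x)-\omega'(x)|$ and its Borel $\sigma$-field. $\omega=(\omega(x))_{x\in\mathbb{Z}}$ is a family of i.i.d. $[0,1]$-valued random variables, $\mathbb{P}$ is its law on $\Omega$, $\mathbb{E}$ the expectation, and $\rho_x=\frac{1-\omega(x)}{\omega(x)}$. For $x\in\mathbb{Z}$, $(T_x\omega)(y)=\omega(x+y)$. The kernel of the environment seen from the particle is $R(\omega,d\omega')=\omega(0)\,\delta_{T_1\omega}(d\omega')+(1-\omega(0))\,\delta_{T_{-1}\omega}(d\omega')$. Reversibility of a probability $\mathbb{Q}$ means $\int F\cdot RG\,d\mathbb{Q}=\int G\cdot RF\,d\mathbb{Q}$ for all bounded continuous $F,G:\Omega\to\mathbb{R}$; invariance means $\int RF\,d\mathbb{Q}=\int F\,d\mathbb{Q}$ for such $F$. The potential is $V(x)=\sum_{y=1}^x\log\rho_y$ for $x>0$, $V(0)=0$, $V(x)=-\sum_{y=x+1}^0\log\rho_y$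 for $x<0$. Let $\widetilde V=(\widetilde V(x))_{x\in\mathbb{Z}}$ be distributed as $V$ conditioned to stay non-negative at all $x\ge0$ and positive at all $x<0$; since this event has probability zero, the conditioning is understood in the sense of Doob's $h$-transform (equivalently, the law of $\widetilde V$ is the limit, in the sense of finite-dimensional distributions, as $N\to\infty$, of the law of $V$ conditioned on $\{V(x)\ge0\ \forall\, 0\le x\le N,\ V(x)>0\ \forall\, -N\le x<0\}$). It is known that $\sum_{x\in\mathbb{Z}}e^{-\widetilde V(x)}<\infty$ a.s. Let $\mathcal{E}$ denote expectation with respect to the law of $\widetilde V$. Define, for $x\in\mathbb{Z}$, $$\widetilde\omega(x)=\frac{e^{-\widetilde V(x)}}{e^{-\widetilde V(x)}+e^{-\widetilde V(x-1)}},\qquad \tilde\nu(x)=\frac{e^{-\widetilde V(x-1)}+e^{-\widetilde V(x)}}{2\sum_{z\in\mathbb{Z}}e^{-\widetilde V(z)}}.$$ The probability measure $\mathbb{Q}$ on $\Omega$ is defined by $$\int_\Omega F\,d\mathbb{Q}=\sum_{x\in\mathbb{Z}}\mathcal{E}\big[\tilde\nu(x)\,F(T_x\widetilde\omega)\big]$$ for bounded measurable $F:\Omega\to\mathbb{R}$. *)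

theory Defs
  imports "HOL-Probability.Probability"
begin

section \<open>The space of environments\<close>

definition env_space :: "(int \<Rightarrow> real) set" where
  "env_space = {\<omega>. \<forall>x. 0 \<le> \<omega> x \<and> \<omega> x \<le> 1}"

definition env_dist :: "(int \<Rightarrow> real) \<Rightarrow> (int \<Rightarrow> real) \<Rightarrow> real" where
  "env_dist \<omega> \<omega>' = (\<Sum>\<^sub>\<infinity>x. (1 / 2) ^ nat \<bar>x\<bar> * \<bar>\<omega> x - \<omega>' x\<bar>)"

definition env_top :: "(int \<Rightarrow> real) topology" where
  "env_top = Metric_space.mtopology env_space env_dist"

text \<open>The Borel $\sigma$-field of the metric space, carried by a measure whose values play no role.\<close>

definition env_borel :: "(int \<Rightarrow> real) measure" where
  "env_borel = sigma env_space {U. openin env_top U}"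

definition shift :: "int \<Rightarrow> (int \<Rightarrow> real) \<Rightarrow> (int \<Rightarrow> real)" where
  "shift x \<omega> = (\<lambda>y. \<omega> (x + y))"

lemma shift_in_env_space: "\<omega> \<in> env_space \<Longrightarrow> shift x \<omega> \<in> env_space"
  by (auto simp: env_space_def shift_def)

lemma summable_on_int_half_power: "(\<lambda>x::int. (1 / 2 :: real) ^ nat \<bar>x\<bar>) summable_on UNIV"
proof -
  have geo: "(\<lambda>n::nat. (1 / 2 :: real) ^ n) summable_on UNIV"
    by (rule norm_summable_imp_summable_on) (simp add: summable_geometric)
  have pos: "(\<lambda>x::int. (1 / 2 :: real) ^ nat \<bar>x\<bar>) summable_on range int"
    using geo by (subst summable_on_reindex) (auto simp: o_def)
  have inj: "inj (\<lambda>n. - int n)"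
    by (auto intro: injI)
  have neg: "(\<lambda>x::int. (1 / 2 :: real) ^ nat \<bar>x\<bar>) summable_on range (\<lambda>n. - int n)"
    using geo by (subst summable_on_reindex[OF inj]) (auto simp: o_def)
  have "range int \<union> range (\<lambda>n. - int n) = UNIV"
  proof -
    have "x \<in> range int \<union> range (\<lambda>n. - int n)" for x :: int
      by (cases x rule: int_cases2) auto
    then show ?thesis
      by blast
  qed
  with summable_on_union[OF pos neg] show ?thesis
    by simp
qed

lemma env_dist_summable:
  assumes "\<omega> \<in> env_space" "\<omega>' \<in> env_space"
  shows "(\<lambda>x. (1 / 2) ^ nat \<bar>x\<bar> * \<bar>\<omega> x - \<omega>' x\<bar>) summable_on UNIV"
proof (rule summable_on_comparison_test[OF summable_on_int_half_power])
  fix x :: int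
  have "\<bar>\<omega> x - \<omega>' x\<bar> \<le> 1"
    using assms unfolding env_space_def by (smt (verit) mem_Collect_eq)
  then show "(1 / 2) ^ nat \<bar>x\<bar> * \<bar>\<omega> x - \<omega>' x\<bar> \<le> (1 / 2) ^ nat \<bar>x\<bar>"
    by (simp add: mult_left_le)
qed auto

lemma Metric_space_env: "Metric_space env_space env_dist"
proof
  fix \<omega> \<omega>' :: "int \<Rightarrow> real"
  show "0 \<le> env_dist \<omega> \<omega>'"
    unfolding env_dist_def by (rule infsum_nonneg) auto
  show "env_dist \<omega> \<omega>' = env_dist \<omega>' \<omega>"
    unfolding env_dist_def by (simp add: abs_minus_commute)
next
  fix \<omega> \<omega>' :: "int \<Rightarrow> real"
  assume in_env: "\<omega> \<in> env_space" "\<omega>' \<in> env_space"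
  show "env_dist \<omega> \<omega>' = 0 \<longleftrightarrow> \<omega> = \<omega>'"
  proof
    assume zero: "env_dist \<omega> \<omega>' = 0"
    have "(1 / 2) ^ nat \<bar>x\<bar> * \<bar>\<omega> x - \<omega>' x\<bar> = 0" for x
      using nonneg_infsum_le_0D[OF _ env_dist_summable[OF in_env], of x] zero
      unfolding env_dist_def by auto
    then show "\<omega> = \<omega>'"
      by (auto simp: fun_eq_iff)
  qed (simp add: env_dist_def)
next
  fix \<omega> \<omega>' \<omega>'' :: "int \<Rightarrow> real"
  assume in_env: "\<omega> \<in> env_space" "\<omega>' \<in> env_space" "\<omega>'' \<in> env_space"
  let ?t = "\<lambda>(a :: int \<Rightarrow> real) b x. (1 / 2) ^ nat \<bar>x\<bar> * \<bar>a x - b x\<bar>"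
  have s: "?t \<omega> \<omega>' summable_on UNIV" "?t \<omega>' \<omega>'' summable_on UNIV"
    using in_env by (auto intro: env_dist_summable)
  have "env_dist \<omega> \<omega>'' \<le> (\<Sum>\<^sub>\<infinity>x. ?t \<omega> \<omega>' x + ?t \<omega>' \<omega>'' x)"
    unfolding env_dist_def
  proof (rule infsum_mono)
    show "?t \<omega> \<omega>'' summable_on UNIV"
      using in_env by (auto intro: env_dist_summable)
    show "(\<lambda>x. ?t \<omega> \<omega>' x + ?t \<omega>' \<omega>'' x) summable_on UNIV"
      using s by (rule summable_on_add)
    fix x :: int
    show "?t \<omega> \<omega>'' x \<le> ?t \<omega> \<omega>' x + ?t \<omega>' \<omega>'' x"
      unfolding distrib_left[symmetric] by (rule mult_left_mono) auto
  qed
  also have "\<dots> = env_dist \<omega> \<omega>' + env_dist \<omega>' \<omega>''"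
    unfolding env_dist_def using s by (rule infsum_add)
  finally show "env_dist \<omega> \<omega>'' \<le> env_dist \<omega> \<omega>' + env_dist \<omega>' \<omega>''" .
qed

lemma space_env_borel [simp]: "space env_borel = env_space"
proof -
  have "{U. openin env_top U} \<subseteq> Pow env_space"
    using openin_subset Metric_space.topspace_mtopology[OF Metric_space_env]
    unfolding env_top_def by fastforce
  then show ?thesis
    unfolding env_borel_def by (rule space_measure_of)
qed

section \<open>The environment seen from the particle\<close>

text \<open>With \<open>bernoulli_pmf (\<omega> 0)\<close> deciding between a step to the right and a step to the left,
  this is the two-point law $\omega(0)\,\delta_{T_1\omega} + (1-\omega(0))\,\delta_{T_{-1}\omega}$
  (for \<open>\<omega>\<close> in \<open>env_space\<close>); see \<open>integral_env_kernel\<close>.\<close>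

definition env_kernel :: "(int \<Rightarrow> real) \<Rightarrow> (int \<Rightarrow> real) measure" where
  "env_kernel \<omega> =
     distr (measure_pmf (bernoulli_pmf (\<omega> 0))) env_borel
       (\<lambda>right. if right then shift 1 \<omega> else shift (-1) \<omega>)"

definition kernel_op :: "((int \<Rightarrow> real) \<Rightarrow> real) \<Rightarrow> (int \<Rightarrow> real) \<Rightarrow> real" where
  "kernel_op F \<omega> = (\<integral>\<omega>'. F \<omega>' \<partial>env_kernel \<omega>)"

lemma integral_env_kernel:
  assumes "\<omega> \<in> env_space" and "F \<in> borel_measurable env_borel"
  shows "kernel_op F \<omega> = \<omega> 0 * F (shift 1 \<omega>) + (1 - \<omega> 0) * F (shift (-1) \<omega>)"
proof -
  have p: "0 \<le> \<omega> 0" "\<omega> 0 \<le> 1"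
    using assms(1) by (auto simp: env_space_def)
  have "(\<lambda>right. if right then shift 1 \<omega> else shift (-1) \<omega>)
          \<in> measurable (measure_pmf (bernoulli_pmf (\<omega> 0))) env_borel"
    using assms(1) by (auto simp: measurable_def shift_in_env_space)
  then show ?thesis
    unfolding kernel_op_def env_kernel_def using assms(2) p
    by (subst integral_distr) auto
qed

definition bounded_continuous :: "((int \<Rightarrow> real) \<Rightarrow> real) \<Rightarrow> bool" where
  "bounded_continuous F \<longleftrightarrow> continuous_map env_top euclideanreal F \<and> bounded (F ` env_space)"

definition invariant :: "(int \<Rightarrow> real) measure \<Rightarrow> bool" where
  "invariant Q \<longleftrightarrow>
     (\<forall>F. bounded_continuous F \<longrightarrow> (\<integral>\<omega>. kernel_op F \<omega> \<partial>Q) = (\<integral>\<omega>. F \<omega> \<partial>Q))"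

definition reversible :: "(int \<Rightarrow> real) measure \<Rightarrow> bool" where
  "reversible Q \<longleftrightarrow>
     (\<forall>F G. bounded_continuous F \<longrightarrow> bounded_continuous G \<longrightarrow>
       (\<integral>\<omega>. F \<omega> * kernel_op G \<omega> \<partial>Q) = (\<integral>\<omega>. G \<omega> * kernel_op F \<omega> \<partial>Q))"

definition mutually_singular :: "'a measure \<Rightarrow> 'a measure \<Rightarrow> bool" where
  "mutually_singular M N \<longleftrightarrow>
     sets M = sets N \<and> (\<exists>A\<in>sets M. emeasure M A = 0 \<and> emeasure N (space N - A) = 0)"

section \<open>The potential and the potential conditioned to stay non-negative\<close>

definition rho :: "(int \<Rightarrow> real) \<Rightarrow> int \<Rightarrow> real" where
  "rho \<omega> x = (1 - \<omega> x) / \<omega> x"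

definition potential :: "(int \<Rightarrow> real) \<Rightarrow> int \<Rightarrow> real" where
  "potential \<omega> x =
     (if x > 0 then (\<Sum>y\<in>{1..x}. ln (rho \<omega> y))
      else if x = 0 then 0
      else - (\<Sum>y\<in>{x+1..0}. ln (rho \<omega> y)))"

definition stay_event :: "nat \<Rightarrow> (int \<Rightarrow> real) set" where
  "stay_event N = {\<omega> \<in> env_space.
     (\<forall>x. 0 \<le> x \<and> x \<le> int N \<longrightarrow> potential \<omega> x \<ge> 0) \<and>
     (\<forall>x. - int N \<le> x \<and> x < 0 \<longrightarrow> potential \<omega> x > 0)}"

definition conditioned_law :: "(int \<Rightarrow> real) measure \<Rightarrow> nat \<Rightarrow> (int \<Rightarrow> real) measure" where
  "conditioned_law P N =
     distr (uniform_measure P (stay_event N)) (\<Pi>\<^sub>M x\<in>UNIV. borel) potential"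

text \<open>The event that \<open>V\<close> stays non-negative on the whole right half-line and positive on the whole
  left half-line is null; the law conditioned on it (Doob's h-transform) is taken as the limit of the
  finite-dimensional distributions of \<open>conditioned_law P N\<close>. Here a continuous function on
  $\mathbb{R}^{J}$ is the same as a function on $\mathbb{R}^{\mathbb{Z}}$ that is continuous for
  the product topology and depends on the coordinates in \<open>J\<close> only.\<close>

definition is_conditioned_potential_law ::
  "(int \<Rightarrow> real) measure \<Rightarrow> (int \<Rightarrow> real) measure \<Rightarrow> bool" where
  "is_conditioned_potential_law P L \<longleftrightarrow>
     prob_space L \<and> sets L = sets (\<Pi>\<^sub>M x\<in>(UNIV :: int set). (borel :: real measure)) \<and>
     (\<forall>J f. finite J \<longrightarrow> continuous_on UNIV f \<longrightarrow> bounded (range f) \<longrightarrow>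
        (\<forall>v w. (\<forall>x\<in>J. v x = w x) \<longrightarrow> f v = f w) \<longrightarrow>
        (\<lambda>N. \<integral>v. f v \<partial>conditioned_law P N) \<longlonglongrightarrow> ((\<integral>v. f v \<partial>L) :: real))"

definition tilde_env :: "(int \<Rightarrow> real) \<Rightarrow> (int \<Rightarrow> real)" where
  "tilde_env v = (\<lambda>x. exp (- v x) / (exp (- v x) + exp (- v (x - 1))))"

definition tilde_nu :: "(int \<Rightarrow> real) \<Rightarrow> int \<Rightarrow> real" where
  "tilde_nu v x = (exp (- v (x - 1)) + exp (- v x)) / (2 * (\<Sum>\<^sub>\<infinity>z. exp (- v z)))"

text \<open>The identity for bounded measurable \<open>F\<close> determines \<open>Q\<close>. Since \<open>tilde_nu v\<close> is \<open>0\<close> when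
  $\sum_z e^{-v(z)}$ diverges, the total mass of \<open>Q\<close> is the probability under \<open>L\<close> that the series
  converges, so that such a probability measure exists exactly when it converges almost surely.\<close>

definition is_env_measure :: "(int \<Rightarrow> real) measure \<Rightarrow> (int \<Rightarrow> real) measure \<Rightarrow> bool" where
  "is_env_measure L Q \<longleftrightarrow>
     prob_space Q \<and> sets Q = sets env_borel \<and>
     (\<forall>F\<in>borel_measurable env_borel. bounded (F ` env_space) \<longrightarrow>
        ((\<lambda>x. \<integral>v. tilde_nu v x * F (shift x (tilde_env v)) \<partial>L) has_sum (\<integral>\<omega>. F \<omega> \<partial>Q)) UNIV)"

end

theory Submission
  imports Defs
begin

text \<open>Reversibility is detailed balance for a nearest-neighbour walk given by conductances. Given
  \<open>v\<close>, a particle placed at \<open>x\<close> with weight \<open>tilde_nu v x\<close> jumps to \<open>x + 1\<close> with the same weight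
  with which a particle placed at \<open>x + 1\<close> jumps to \<open>x\<close>, namely the normalised conductance
  \<open>exp (- v x) / (2 * (\<Sum>z. exp (- v z)))\<close>. Summing over the position of the particle gives
  \<open>env_measure_detailed_balance\<close>, and the choice of a constant test function gives invariance.

  Singularity comes from an event that \<open>P\<close> and \<open>Q\<close> treat in opposite ways: the potential of the
  environment tends to \<open>+\<infinity>\<close> at both ends of the line. Under \<open>Q\<close> it is certain. The environment
  \<open>tilde_env v\<close> has potential \<open>v - v 0\<close>, shifting it only moves the potential and adds a constant,
  and a convergent series \<open>\<Sum>z. exp (- v z)\<close> forces \<open>v\<close> to escape on both sides
  (\<open>env_measure_not_escaping_eq_0\<close>). Under \<open>P\<close> it is null (\<open>prob_escaping_eq_0\<close>): the potential at
  \<open>n\<close> is a sum of \<open>n\<close> i.i.d. variables, the potential at \<open>-n\<close> is the negative of a sum with the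
  same law. By Kolmogorov's zero-one law, escape on both sides with positive probability would
  make both escapes almost sure, so that two equally distributed sums would, for large \<open>n\<close>, be
  positive and negative respectively with probability above \<open>1/2\<close>.\<close>

section \<open>Sums of i.i.d. variables do not escape in opposite directions\<close>

lemma filterlim_at_top_iff_nat_bounds:
  fixes f :: "nat \<Rightarrow> real"
  shows "filterlim f at_top sequentially \<longleftrightarrow> (\<forall>k::nat. \<exists>m. \<forall>n\<ge>m. real k \<le> f n)"
proof
  assume "filterlim f at_top sequentially"
  then show "\<forall>k::nat. \<exists>m. \<forall>n\<ge>m. real k \<le> f n"
    unfolding filterlim_at_top eventually_sequentially by blast
next
  assume R: "\<forall>k::nat. \<exists>m. \<forall>n\<ge>m. real k \<le> f n"
  show "filterlim f at_top sequentially"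
    unfolding filterlim_at_top eventually_sequentially
  proof
    fix Z :: real
    obtain k :: nat where "Z \<le> real k"
      using real_arch_simple by blast
    with R show "\<exists>m. \<forall>n\<ge>m. Z \<le> f n"
      by (meson order_trans)
  qed
qed

lemma sets_filterlim_at_top:
  fixes Y :: "nat \<Rightarrow> 'a \<Rightarrow> real"
  assumes [measurable]: "\<And>n. Y n \<in> borel_measurable M"
  shows "{\<omega> \<in> space M. filterlim (\<lambda>n. Y n \<omega>) at_top sequentially} \<in> sets M"
  unfolding filterlim_at_top_iff_nat_bounds by measurable

lemma (in prob_space) indep_vars_reindex_inj:
  assumes "indep_vars (\<lambda>_. N) X UNIV" and "inj g"
  shows "indep_vars (\<lambda>_. N) (\<lambda>i. X (g i)) UNIV"
proof -
  let ?F = "\<lambda>i. {X i -` A \<inter> space M |A. A \<in> sets N}"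
  have rv: "random_variable N (X i)" for i
    using assms(1) by (auto simp: indep_vars_def2)
  have ind: "indep_sets ?F UNIV"
    using assms(1) by (simp add: indep_vars_def2)
  have "indep_sets (\<lambda>i. ?F (g i)) UNIV"
  proof (rule indep_setsI)
    show "?F (g i) \<subseteq> events" for i
      using rv by (auto intro: measurable_sets)
  next
    fix A J assume J: "J \<noteq> {}" "J \<subseteq> UNIV" "finite J" and A: "\<forall>j\<in>J. A j \<in> ?F (g j)"
    have "prob (\<Inter>j\<in>g ` J. A (inv g j)) = (\<Prod>j\<in>g ` J. prob (A (inv g j)))"
      using J A \<open>inj g\<close> by (intro indep_setsD[OF ind]) auto
    then show "prob (\<Inter>j\<in>J. A j) = (\<Prod>j\<in>J. prob (A j))"
      using \<open>inj g\<close> by (simp add: prod.reindex inj_on_subset[OF \<open>inj g\<close>] image_image)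
  qed
  with rv show ?thesis
    by (simp add: indep_vars_def2)
qed

lemma (in prob_space) distr_sum_cong:
  fixes Y Z :: "nat \<Rightarrow> 'a \<Rightarrow> real"
  assumes Y: "indep_vars (\<lambda>_. borel) Y UNIV" and Z: "indep_vars (\<lambda>_. borel) Z UNIV"
    and same: "\<And>i. distr M borel (Y i) = distr M borel (Z i)"
  shows "distr M borel (\<lambda>\<omega>. \<Sum>i<n. Y i \<omega>) = distr M borel (\<lambda>\<omega>. \<Sum>i<n. Z i \<omega>)"
proof (rule Levy_uniqueness)
  have [measurable]: "random_variable borel (Y i)" "random_variable borel (Z i)" for i
    using Y Z by (auto simp: indep_vars_def2)
  show "real_distribution (distr M borel (\<lambda>\<omega>. \<Sum>i<n. Y i \<omega>))"
    "real_distribution (distr M borel (\<lambda>\<omega>. \<Sum>i<n. Z i \<omega>))"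
    by (auto intro!: real_distribution_distr)
  show "char (distr M borel (\<lambda>\<omega>. \<Sum>i<n. Y i \<omega>)) = char (distr M borel (\<lambda>\<omega>. \<Sum>i<n. Z i \<omega>))"
    using indep_vars_subset[OF Y, of "{..<n}"] indep_vars_subset[OF Z, of "{..<n}"]
    by (simp add: fun_eq_iff char_distr_sum same)
qed

text \<open>Dropping the first \<open>n\<close> summands shifts all later partial sums by one finite number, so escape
  is decided by the variables from \<open>n\<close> on, for every \<open>n\<close>: it is a tail event and Kolmogorov's
  law applies.\<close>

lemma (in prob_space) prob_sum_escape_0_1:
  fixes Y :: "nat \<Rightarrow> 'a \<Rightarrow> real"
  assumes indep: "indep_vars (\<lambda>_. borel) Y UNIV"
  defines "E \<equiv> {\<omega> \<in> space M. filterlim (\<lambda>n. \<Sum>i<n. Y i \<omega>) at_top sequentially}"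
  shows "prob E = 0 \<or> prob E = 1"
proof -
  define F where "F i = sigma_sets (space M) {Y i -` B \<inter> space M | B. B \<in> sets borel}" for i
  have "E \<in> sigma_sets (space M) (\<Union> (F ` {n..}))" for n
  proof -
    define S where "S = sigma (space M) (\<Union> (F ` {n..}))"
    have F: "F i \<subseteq> Pow (space M)" for i
    proof
      show "A \<in> Pow (space M)" if "A \<in> F i" for A
        using sigma_sets_into_sp[OF _ that[unfolded F_def]] by blast
    qed
    then have sub: "\<Union> (F ` {n..}) \<subseteq> Pow (space M)"
      by blast
    then have space: "space S = space M" and sets: "sets S = sigma_sets (space M) (\<Union> (F ` {n..}))"
      by (simp_all add: S_def)
    have Y [measurable]: "Y (n + i) \<in> borel_measurable S" for i
    proof (rule measurableI)
      fix B :: "real set" assume "B \<in> sets borel"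
      then have "Y (n + i) -` B \<inter> space M \<in> F (n + i)"
        unfolding F_def by blast
      then show "Y (n + i) -` B \<inter> space S \<in> sets S"
        unfolding space sets by (intro sigma_sets.Basic) auto
    qed simp
    have "filterlim (\<lambda>k. \<Sum>i<k. Y i \<omega>) at_top sequentially \<longleftrightarrow>
        filterlim (\<lambda>k. \<Sum>i<k. Y (n + i) \<omega>) at_top sequentially" for \<omega>
    proof -
      have "filterlim (\<lambda>k. \<Sum>i<k. Y i \<omega>) at_top sequentially \<longleftrightarrow>
          filterlim (\<lambda>k. \<Sum>i<n + k. Y i \<omega>) at_top sequentially"
      proof (induction n)
        case (Suc n)
        have "filterlim (\<lambda>k. \<Sum>i<Suc n + k. Y i \<omega>) at_top sequentially \<longleftrightarrow>
            filterlim (\<lambda>k. \<Sum>i<n + k. Y i \<omega>) at_top sequentially"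
          using filterlim_sequentially_Suc[of "\<lambda>k. \<Sum>i<n + k. Y i \<omega>" at_top]
          by (simp only: add_Suc add_Suc_right)
        with Suc show ?case
          by (simp only:)
      qed simp
      also have "(\<lambda>k. \<Sum>i<n + k. Y i \<omega>) = (\<lambda>k. (\<Sum>i<n. Y i \<omega>) + (\<Sum>i<k. Y (n + i) \<omega>))"
      proof
        show "(\<Sum>i<n + k. Y i \<omega>) = (\<Sum>i<n. Y i \<omega>) + (\<Sum>i<k. Y (n + i) \<omega>)" for k
          by (induction k) auto
      qed
      also have "filterlim \<dots> at_top sequentially \<longleftrightarrow>
          filterlim (\<lambda>k. \<Sum>i<k. Y (n + i) \<omega>) at_top sequentially"
        by (rule filterlim_tendsto_add_at_top_iff[OF tendsto_const])
      finally show ?thesis .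
    qed
    then have "E = {\<omega> \<in> space S. filterlim (\<lambda>k. \<Sum>i<k. Y (n + i) \<omega>) at_top sequentially}"
      by (simp add: E_def space)
    also have "\<dots> \<in> sets S"
      by (rule sets_filterlim_at_top) measurable
    finally show ?thesis
      by (simp add: sets)
  qed
  then have "E \<in> tail_events F"
    unfolding tail_events_def by (rule INT_I)
  moreover have "sigma_algebra (space M) (F i)" for i
    unfolding F_def by (rule sigma_algebra_sigma_sets) auto
  moreover have "indep_sets F UNIV"
    using indep by (simp add: indep_vars_def F_def[abs_def])
  ultimately show ?thesis
    by (intro kolmogorov_0_1_law)
qed

text \<open>The events that all terms from \<open>m\<close> on are positive increase with \<open>m\<close> and exhaust almost the
  whole space, so the probability even tends to \<open>1\<close>. The bound \<open>1/2\<close> is chosen because two disjoint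
  events cannot both exceed it.\<close>

lemma (in prob_space) eventually_likely_positive:
  fixes Y :: "nat \<Rightarrow> 'a \<Rightarrow> real"
  assumes [measurable]: "\<And>n. random_variable borel (Y n)"
    and 1: "prob {\<omega> \<in> space M. filterlim (\<lambda>n. Y n \<omega>) at_top sequentially} = 1"
  shows "\<forall>\<^sub>F n in sequentially. prob {\<omega> \<in> space M. 0 < Y n \<omega>} > 1 / 2"
proof -
  define B where "B m = {\<omega> \<in> space M. \<forall>n\<ge>m. 0 < Y n \<omega>}" for m
  have [measurable]: "B m \<in> events" for m
    unfolding B_def by measurable
  have "incseq B"
    by (auto simp: incseq_def B_def)
  then have lim: "(\<lambda>m. prob (B m)) \<longlonglongrightarrow> prob (\<Union>m. B m)"
    by (intro finite_Lim_measure_incseq) auto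
  have "{\<omega> \<in> space M. filterlim (\<lambda>n. Y n \<omega>) at_top sequentially} \<subseteq> (\<Union>m. B m)"
    by (auto simp: filterlim_at_top_dense eventually_sequentially B_def)
  then have "1 \<le> prob (\<Union>m. B m)"
    unfolding 1[symmetric] by (intro finite_measure_mono) auto
  then have "\<forall>\<^sub>F m in sequentially. prob (B m) > 1 / 2"
    by (intro order_tendstoD(1)[OF lim]) simp
  then show ?thesis
  proof eventually_elim
    case (elim m)
    have "prob (B m) \<le> prob {\<omega> \<in> space M. 0 < Y m \<omega>}"
      by (intro finite_measure_mono) (auto simp: B_def)
    with elim show ?case
      by simp
  qed
qed

text \<open>If the joint escape had positive probability, both escapes would be almost sure by the zero-one
  law. For large \<open>n\<close> the \<open>n\<close>-th partial sum of \<open>Y\<close> would be positive, and that of \<open>Z\<close> negative,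
  with probability above \<open>1/2\<close>; but the two partial sums have the same law, and the events that
  the second one is positive and negative are disjoint.\<close>

lemma (in prob_space) prob_opposite_escape_eq_0:
  fixes Y Z :: "nat \<Rightarrow> 'a \<Rightarrow> real"
  assumes Y: "indep_vars (\<lambda>_. borel) Y UNIV" and Z: "indep_vars (\<lambda>_. borel) Z UNIV"
    and same: "\<And>i. distr M borel (Y i) = distr M borel (Z i)"
  shows "prob ({\<omega> \<in> space M. filterlim (\<lambda>n. \<Sum>i<n. Y i \<omega>) at_top sequentially} \<inter>
    {\<omega> \<in> space M. filterlim (\<lambda>n. \<Sum>i<n. - Z i \<omega>) at_top sequentially}) = 0"
    (is "prob (?E \<inter> ?E') = 0")
proof (rule ccontr)
  assume nz: "prob (?E \<inter> ?E') \<noteq> 0"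
  have [measurable]: "random_variable borel (Y i)" "random_variable borel (Z i)" for i
    using Y Z by (auto simp: indep_vars_def2)
  have [measurable]: "?E \<in> events" "?E' \<in> events"
    by (intro sets_filterlim_at_top; measurable)+
  have "prob (?E \<inter> ?E') \<le> prob ?E" "prob (?E \<inter> ?E') \<le> prob ?E'"
    by (auto intro!: finite_measure_mono)
  moreover have "0 < prob (?E \<inter> ?E')"
    using nz by (simp add: zero_less_measure_iff)
  ultimately have "prob ?E \<noteq> 0" "prob ?E' \<noteq> 0"
    by linarith+
  then have "prob ?E = 1" "prob ?E' = 1"
    using prob_sum_escape_0_1[OF Y] prob_sum_escape_0_1[OF indep_vars_compose2[OF Z, of "\<lambda>_. uminus"]]
    by auto
  then have "\<forall>\<^sub>F n in sequentially. prob {\<omega> \<in> space M. 0 < (\<Sum>i<n. Y i \<omega>)} > 1 / 2 \<and>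
      prob {\<omega> \<in> space M. 0 < (\<Sum>i<n. - Z i \<omega>)} > 1 / 2"
    by (intro eventually_conj eventually_likely_positive) auto
  then obtain n where n: "prob {\<omega> \<in> space M. 0 < (\<Sum>i<n. Y i \<omega>)} > 1 / 2"
      "prob {\<omega> \<in> space M. 0 < (\<Sum>i<n. - Z i \<omega>)} > 1 / 2"
    using eventually_happens'[OF sequentially_bot] by blast
  have "prob {\<omega> \<in> space M. 0 < (\<Sum>i<n. Y i \<omega>)}
      = measure (distr M borel (\<lambda>\<omega>. \<Sum>i<n. Y i \<omega>)) {0<..}"
    by (subst measure_distr) (auto intro!: arg_cong[where f = prob])
  also have "\<dots> = measure (distr M borel (\<lambda>\<omega>. \<Sum>i<n. Z i \<omega>)) {0<..}"
    by (simp add: distr_sum_cong[OF Y Z same])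
  also have "\<dots> = prob {\<omega> \<in> space M. 0 < (\<Sum>i<n. Z i \<omega>)}"
    by (subst measure_distr) (auto intro!: arg_cong[where f = prob])
  finally have "1 < prob {\<omega> \<in> space M. 0 < (\<Sum>i<n. Z i \<omega>)} + prob {\<omega> \<in> space M. 0 < (\<Sum>i<n. - Z i \<omega>)}"
    using n by linarith
  also have "\<dots> = prob ({\<omega> \<in> space M. 0 < (\<Sum>i<n. Z i \<omega>)} \<union> {\<omega> \<in> space M. 0 < (\<Sum>i<n. - Z i \<omega>)})"
    by (intro finite_measure_Union[symmetric]) (auto simp: sum_negf)
  finally show False
    using prob_le_1 by (simp add: not_less[symmetric])
qed

section \<open>Environments whose potential escapes to infinity on both sides\<close>

definition escaping :: "(int \<Rightarrow> real) set" where
  "escaping = {\<omega> \<in> env_space.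
     filterlim (\<lambda>n. potential \<omega> (int n)) at_top sequentially \<and>
     filterlim (\<lambda>n. potential \<omega> (- int n)) at_top sequentially}"

lemma potential_of_nat: "potential \<omega> (int n) = (\<Sum>i<n. ln (rho \<omega> (1 + int i)))"
proof -
  have "(\<Sum>y\<in>{1..int n}. ln (rho \<omega> y)) = (\<Sum>i<n. ln (rho \<omega> (1 + int i)))"
    by (rule sum.reindex_bij_witness[of _ "\<lambda>i. 1 + int i" "\<lambda>y. nat (y - 1)"]) auto
  then show ?thesis
    by (auto simp: potential_def)
qed

lemma potential_minus_of_nat: "potential \<omega> (- int n) = (\<Sum>i<n. - ln (rho \<omega> (- int i)))"
proof -
  have "(\<Sum>y\<in>{- int n + 1..0}. ln (rho \<omega> y)) = (\<Sum>i<n. ln (rho \<omega> (- int i)))"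
    by (rule sum.reindex_bij_witness[of _ "\<lambda>i. - int i" "\<lambda>y. nat (- y)"]) auto
  then show ?thesis
    by (auto simp: potential_def sum_negf)
qed

text \<open>The sites \<open>1, 2, \<dots>\<close> to the right of the origin and \<open>0, -1, \<dots>\<close> read towards the left carry
  two i.i.d. sequences \<open>ln \<rho>\<close> with the same law; the potential adds up the first and subtracts the
  second.\<close>

lemma prob_escaping_eq_0:
  assumes "prob_space P" and sets: "sets P = sets env_borel"
    and indep: "prob_space.indep_vars P (\<lambda>_. borel) (\<lambda>x \<omega>. \<omega> x) (UNIV :: int set)"
    and same: "\<forall>x. distr P borel (\<lambda>\<omega>. \<omega> x) = distr P borel (\<lambda>\<omega>. \<omega> (0::int))"
  shows "escaping \<in> sets P \<and> emeasure P escaping = 0"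
proof -
  interpret prob_space P by fact
  have space: "space P = env_space"
    using sets_eq_imp_space_eq[OF sets] by simp
  define X where "X x \<omega> = ln (rho \<omega> x)" for x and \<omega> :: "int \<Rightarrow> real"
  have coord [measurable]: "(\<lambda>\<omega>. \<omega> x) \<in> borel_measurable P" for x
    using indep by (auto simp: indep_vars_def2)
  have f [measurable]: "(\<lambda>p::real. ln ((1 - p) / p)) \<in> borel_measurable borel"
    by measurable
  have X [measurable]: "X x \<in> borel_measurable P" for x
    unfolding X_def rho_def by measurable
  have "indep_vars (\<lambda>_. borel) X UNIV"
    using indep_vars_compose2[OF indep f] by (simp add: X_def[abs_def] rho_def)
  then have ind: "indep_vars (\<lambda>_. borel) (\<lambda>i::nat. X (1 + int i)) UNIV"
      "indep_vars (\<lambda>_. borel) (\<lambda>i::nat. X (- int i)) UNIV"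
    by (auto intro!: indep_vars_reindex_inj injI)
  have "distr P borel (X x) = distr (distr P borel (\<lambda>\<omega>. \<omega> x)) borel (\<lambda>p. ln ((1 - p) / p))" for x
    by (simp add: distr_distr comp_def X_def[abs_def] rho_def)
  then have "distr P borel (X x) = distr P borel (X y)" for x y
    using same by metis
  then have "prob ({\<omega> \<in> space P. filterlim (\<lambda>n. \<Sum>i<n. X (1 + int i) \<omega>) at_top sequentially} \<inter>
      {\<omega> \<in> space P. filterlim (\<lambda>n. \<Sum>i<n. - X (- int i) \<omega>) at_top sequentially}) = 0" (is "prob ?A = 0")
    by (intro prob_opposite_escape_eq_0 ind) auto
  moreover have "?A = escaping"
    by (auto simp: escaping_def potential_of_nat potential_minus_of_nat X_def space)
  moreover have "?A \<in> events"
    by (intro sets.Int sets_filterlim_at_top) measurable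
  ultimately show ?thesis
    by (simp add: emeasure_eq_measure)
qed

lemma potential_eq_increment:
  assumes "\<And>y. ln (rho \<omega> y) = u y - u (y - 1)"
  shows "potential \<omega> x = u x - u 0"
proof (cases x rule: int_cases2)
  case (nonneg n)
  have "potential \<omega> (int n) = u (int n) - u 0"
    unfolding potential_of_nat assms
    by (induction n) (auto simp: algebra_simps)
  with nonneg show ?thesis
    by simp
next
  case (nonpos n)
  have "potential \<omega> (- int n) = u (- int n) - u 0"
    unfolding potential_minus_of_nat assms
  proof (induction n)
    case (Suc n)
    have "u (- 1 - int n) = u (- int n - 1)"
      by (rule arg_cong) simp
    with Suc show ?case
      by simp
  qed simp
  with nonpos show ?thesis
    by simp
qed

lemma tilde_env_in_env_space: "tilde_env v \<in> env_space"
  by (auto simp: env_space_def tilde_env_def field_simps add_pos_pos less_imp_le)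

lemma rho_tilde_env: "rho (tilde_env v) x = exp (v x - v (x - 1))"
proof -
  have pos: "exp (- v x) + exp (- v (x - 1)) \<noteq> 0"
    by (metis add_pos_pos exp_gt_zero less_irrefl)
  then have "1 - tilde_env v x = exp (- v (x - 1)) / (exp (- v x) + exp (- v (x - 1)))"
    by (simp add: tilde_env_def field_simps)
  then have "rho (tilde_env v) x = exp (- v (x - 1)) / exp (- v x)"
    using pos by (simp add: rho_def tilde_env_def)
  then show ?thesis
    by (simp add: exp_diff[symmetric])
qed

lemma potential_shift_tilde_env: "potential (shift a (tilde_env v)) x = v (a + x) - v a"
proof -
  have "ln (rho (shift a (tilde_env v)) y) = v (a + y) - v (a + (y - 1))" for y
    using rho_tilde_env[of v "a + y"] by (simp add: rho_def shift_def algebra_simps)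
  from potential_eq_increment[of _ "\<lambda>y. v (a + y)", OF this] show ?thesis
    by simp
qed

lemma summable_exp_imp_filterlim_at_top:
  fixes v :: "'a \<Rightarrow> real" and g :: "nat \<Rightarrow> 'a"
  assumes "(\<lambda>z. exp (- v z)) summable_on UNIV" and "inj g"
  shows "filterlim (\<lambda>n. v (g n)) at_top sequentially"
proof -
  have "(\<lambda>z. exp (- v z)) summable_on range g"
    using assms(1) by (rule summable_on_subset_banach) auto
  then have "(\<lambda>n. exp (- v (g n))) summable_on UNIV"
    using assms(2) by (simp add: summable_on_reindex comp_def)
  then have "(\<lambda>n. exp (- v (g n))) \<longlonglongrightarrow> 0"
    by (intro summable_LIMSEQ_zero summable_on_imp_summable)
  then have "\<forall>\<^sub>F n in sequentially. exp (- v (g n)) < exp (- Z)" for Z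
    by (rule order_tendstoD) simp
  then show ?thesis
    by (simp add: filterlim_at_top_dense)
qed

lemma shift_tilde_env_escaping:
  assumes "(\<lambda>z. exp (- v z)) summable_on UNIV"
  shows "shift a (tilde_env v) \<in> escaping"
proof -
  have lim: "filterlim (\<lambda>n. v (g n) - v a) at_top sequentially" if "inj g" for g :: "nat \<Rightarrow> int"
    using filterlim_tendsto_add_at_top[OF tendsto_const[of "- v a"]
        summable_exp_imp_filterlim_at_top[OF assms that]] by simp
  have "filterlim (\<lambda>n. v (a + int n) - v a) at_top sequentially"
      "filterlim (\<lambda>n. v (a + - int n) - v a) at_top sequentially"
    by (rule lim, simp add: inj_def)+
  then show ?thesis
    by (simp add: escaping_def potential_shift_tilde_env shift_in_env_space tilde_env_in_env_space)
qed

text \<open>Every term of the series that defines the mass of the complement vanishes identically: where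
  \<open>\<Sum>z. exp (- v z)\<close> converges the shifted environment is escaping, and where it diverges the
  weight \<open>tilde_nu v x\<close> is \<open>0\<close>, because the divergent sum has the default value \<open>0\<close> and so has a
  quotient by it.\<close>

lemma env_measure_not_escaping_eq_0:
  assumes Q: "is_env_measure L Q" and meas: "escaping \<in> sets Q"
  shows "emeasure Q (space Q - escaping) = 0"
proof -
  have prob: "prob_space Q" and sets: "sets Q = sets env_borel"
    using Q by (auto simp: is_env_measure_def)
  interpret prob_space Q by (rule prob)
  have space: "space Q = env_space"
    using sets_eq_imp_space_eq[OF sets] by simp
  let ?F = "indicator (space Q - escaping) :: (int \<Rightarrow> real) \<Rightarrow> real"
  have "?F \<in> borel_measurable env_borel"
    using meas unfolding sets[symmetric] measurable_cong_sets[OF sets[symmetric] refl] by measurable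
  moreover have "bounded (?F ` env_space)"
    by (rule boundedI[of _ 1]) (auto simp: indicator_def)
  ultimately have "((\<lambda>x. \<integral>v. tilde_nu v x * ?F (shift x (tilde_env v)) \<partial>L) has_sum (\<integral>\<omega>. ?F \<omega> \<partial>Q)) UNIV"
    using Q by (auto simp: is_env_measure_def)
  moreover have "tilde_nu v x * ?F (shift x (tilde_env v)) = 0" for v x
  proof (cases "(\<lambda>z. exp (- v z)) summable_on UNIV")
    case True
    then show ?thesis
      by (simp add: shift_tilde_env_escaping)
  next
    case False
    then show ?thesis
      by (simp add: tilde_nu_def infsum_not_exists)
  qed
  ultimately have "(\<integral>\<omega>. ?F \<omega> \<partial>Q) = 0"
    using has_sum_unique[OF _ has_sum_0] by fastforce
  then show ?thesis
    using meas by (simp add: emeasure_eq_measure)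
qed

section \<open>Detailed balance\<close>

lemma env_dist_shift_le:
  assumes "\<omega> \<in> env_space" "\<omega>' \<in> env_space"
  shows "env_dist (shift a \<omega>) (shift a \<omega>') \<le> 2 ^ nat \<bar>a\<bar> * env_dist \<omega> \<omega>'"
proof -
  let ?t = "\<lambda>x. (1 / 2) ^ nat \<bar>x\<bar> * \<bar>\<omega> x - \<omega>' x\<bar>"
  have bij: "bij_betw (\<lambda>x. a + x) UNIV (UNIV :: int set)"
    by (rule bij_betwI[of _ _ _ "\<lambda>x. x - a"]) auto
  have sum: "(\<lambda>x. ?t (a + x)) summable_on UNIV"
    using env_dist_summable[OF assms] by (subst summable_on_reindex_bij_betw[OF bij])
  have le: "(1 / 2 :: real) ^ nat \<bar>x\<bar> \<le> 2 ^ nat \<bar>a\<bar> * (1 / 2) ^ nat \<bar>a + x\<bar>" for x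
  proof -
    have "(1 / 2 :: real) ^ (nat \<bar>a\<bar> + nat \<bar>x\<bar>) \<le> (1 / 2) ^ nat \<bar>a + x\<bar>"
      by (rule power_decreasing) auto
    then show ?thesis
      by (simp add: power_add field_simps)
  qed
  have "env_dist (shift a \<omega>) (shift a \<omega>') \<le> (\<Sum>\<^sub>\<infinity>x. 2 ^ nat \<bar>a\<bar> * ?t (a + x))"
    unfolding env_dist_def
  proof (rule infsum_mono)
    show "(\<lambda>x. (1 / 2) ^ nat \<bar>x\<bar> * \<bar>shift a \<omega> x - shift a \<omega>' x\<bar>) summable_on UNIV"
      by (intro env_dist_summable shift_in_env_space assms)
    show "(\<lambda>x. 2 ^ nat \<bar>a\<bar> * ?t (a + x)) summable_on UNIV"
      by (rule summable_on_cmult_right[OF sum])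
    show "(1 / 2) ^ nat \<bar>x\<bar> * \<bar>shift a \<omega> x - shift a \<omega>' x\<bar> \<le> 2 ^ nat \<bar>a\<bar> * ?t (a + x)" for x
      using mult_right_mono[OF le[of x], of "\<bar>shift a \<omega> x - shift a \<omega>' x\<bar>"]
      by (simp add: shift_def mult.assoc)
  qed
  also have "\<dots> = 2 ^ nat \<bar>a\<bar> * (\<Sum>\<^sub>\<infinity>x. ?t (a + x))"
    by (rule infsum_cmult_right) (use sum in simp)
  also have "(\<Sum>\<^sub>\<infinity>x. ?t (a + x)) = env_dist \<omega> \<omega>'"
    unfolding env_dist_def by (rule infsum_reindex_bij_betw[OF bij])
  finally show ?thesis .
qed

lemma continuous_map_shift: "continuous_map env_top env_top (shift a)"
  unfolding env_top_def Metric_space.metric_continuous_map[OF Metric_space_env Metric_space_env]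
proof (intro conjI ballI allI impI)
  show "shift a ` env_space \<subseteq> env_space"
    by (auto intro: shift_in_env_space)
  fix \<omega> and e :: real assume \<omega>: "\<omega> \<in> env_space" and "0 < e"
  show "\<exists>d>0. \<forall>\<omega>'. \<omega>' \<in> env_space \<and> env_dist \<omega> \<omega>' < d \<longrightarrow> env_dist (shift a \<omega>) (shift a \<omega>') < e"
  proof (intro exI[of _ "e / 2 ^ nat \<bar>a\<bar>"] conjI allI impI)
    show "0 < e / 2 ^ nat \<bar>a\<bar>"
      using \<open>0 < e\<close> by simp
    fix \<omega>' assume "\<omega>' \<in> env_space \<and> env_dist \<omega> \<omega>' < e / 2 ^ nat \<bar>a\<bar>"
    then show "env_dist (shift a \<omega>) (shift a \<omega>') < e"
      using env_dist_shift_le[OF \<omega>, of \<omega>' a] by (simp add: field_simps)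
  qed
qed

lemma topspace_env_top [simp]: "topspace env_top = env_space"
  by (simp add: env_top_def Metric_space.topspace_mtopology[OF Metric_space_env])

lemma openin_env_top_sets: "openin env_top U \<Longrightarrow> U \<in> sets env_borel"
  unfolding env_borel_def using openin_subset[of env_top]
  by (subst sets_measure_of) (auto intro: sigma_sets.Basic)

lemma continuous_map_measurable_env_borel:
  fixes F :: "(int \<Rightarrow> real) \<Rightarrow> 'b::topological_space"
  assumes "continuous_map env_top euclidean F"
  shows "F \<in> borel_measurable env_borel"
proof (rule borel_measurableI)
  fix S :: "'b set" assume "open S"
  then have "openin env_top {\<omega> \<in> topspace env_top. F \<omega> \<in> S}"
    using assms by (intro openin_continuous_map_preimage) auto
  then show "F -` S \<inter> space env_borel \<in> sets env_borel"
    using openin_env_top_sets by (simp add: vimage_def Int_def conj_commute)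
qed

lemma measurable_shift: "shift a \<in> measurable env_borel env_borel"
proof -
  have "shift a \<in> measurable env_borel (sigma env_space {U. openin env_top U})"
  proof (rule measurable_measure_of)
    show "{U. openin env_top U} \<subseteq> Pow env_space"
      using openin_subset[of env_top] by auto
    show "shift a \<in> space env_borel \<rightarrow> env_space"
      by (auto intro: shift_in_env_space)
    fix U assume "U \<in> {U. openin env_top U}"
    then have "openin env_top {\<omega> \<in> topspace env_top. shift a \<omega> \<in> U}"
      using continuous_map_shift by (intro openin_continuous_map_preimage) auto
    then show "shift a -` U \<inter> space env_borel \<in> sets env_borel"
      using openin_env_top_sets by (simp add: vimage_def Int_def conj_commute)
  qed
  then show ?thesis
    by (simp add: env_borel_def)
qed

lemma continuous_map_coordinate: "continuous_map env_top euclideanreal (\<lambda>\<omega>. \<omega> x)"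
proof -
  have "continuous_map (Metric_space.mtopology env_space env_dist) (Metric_space.mtopology UNIV dist)
      (\<lambda>\<omega>. \<omega> x)"
    unfolding Metric_space.metric_continuous_map[OF Metric_space_env Met_TC.Metric_space_axioms]
  proof (intro conjI ballI allI impI)
    fix \<omega> and e :: real assume \<omega>: "\<omega> \<in> env_space" and "0 < e"
    show "\<exists>d>0. \<forall>\<omega>'. \<omega>' \<in> env_space \<and> env_dist \<omega> \<omega>' < d \<longrightarrow> dist (\<omega> x) (\<omega>' x) < e"
    proof (intro exI[of _ "(1 / 2) ^ nat \<bar>x\<bar> * e"] conjI allI impI)
      show "0 < (1 / 2) ^ nat \<bar>x\<bar> * e"
        using \<open>0 < e\<close> by simp
      fix \<omega>' assume \<omega>': "\<omega>' \<in> env_space \<and> env_dist \<omega> \<omega>' < (1 / 2) ^ nat \<bar>x\<bar> * e"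
      let ?t = "\<lambda>y. (1 / 2) ^ nat \<bar>y\<bar> * \<bar>\<omega> y - \<omega>' y\<bar>"
      have "infsum ?t {x} \<le> infsum ?t UNIV"
        using \<omega> \<omega>' by (intro infsum_mono2 env_dist_summable) auto
      then have "?t x \<le> env_dist \<omega> \<omega>'"
        by (simp add: env_dist_def)
      then have "?t x < (1 / 2) ^ nat \<bar>x\<bar> * e"
        using \<omega>' by linarith
      then have "\<bar>\<omega> x - \<omega>' x\<bar> < e"
        by (rule mult_left_less_imp_less) simp
      then show "dist (\<omega> x) (\<omega>' x) < e"
        by (simp add: dist_real_def)
    qed
  qed simp
  then show ?thesis
    by (simp add: env_top_def)
qed

text \<open>The conductance of the edge between \<open>x\<close> and \<open>x + 1\<close> is \<open>exp (- v x)\<close>, up to normalisation: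
  it is the weight with which a particle at \<open>x\<close> jumps right, and with which one at \<open>x + 1\<close>
  jumps left.\<close>

lemma tilde_nu_step_right:
  "tilde_nu v x * tilde_env v x = exp (- v x) / (2 * (\<Sum>\<^sub>\<infinity>z. exp (- v z)))"
proof -
  have "exp (- v x) + exp (- v (x - 1)) \<noteq> 0"
    by (metis add_pos_pos exp_gt_zero less_irrefl)
  then show ?thesis
    by (simp add: tilde_nu_def tilde_env_def add.commute)
qed

lemma tilde_nu_step_left:
  "tilde_nu v (x + 1) * (1 - tilde_env v (x + 1)) = exp (- v x) / (2 * (\<Sum>\<^sub>\<infinity>z. exp (- v z)))"
proof -
  have "exp (- v (x + 1)) + exp (- v x) \<noteq> 0"
    by (metis add_pos_pos exp_gt_zero less_irrefl)
  then have "1 - tilde_env v (x + 1) = exp (- v x) / (exp (- v (x + 1)) + exp (- v x))"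
    by (simp add: tilde_env_def field_simps)
  then show ?thesis
    using \<open>exp (- v (x + 1)) + exp (- v x) \<noteq> 0\<close> by (simp add: tilde_nu_def add.commute)
qed

lemma step_measurable_bounded:
  assumes [measurable]: "F \<in> borel_measurable env_borel" "G \<in> borel_measurable env_borel"
      "p \<in> borel_measurable env_borel"
    and "bounded (F ` env_space)" "bounded (G ` env_space)" "bounded (p ` env_space)"
  shows "(\<lambda>\<omega>. F \<omega> * (p \<omega> * G (shift a \<omega>)) :: real) \<in> borel_measurable env_borel"
    and "bounded ((\<lambda>\<omega>. F \<omega> * (p \<omega> * G (shift a \<omega>)) :: real) ` env_space)"
proof -
  have [measurable]: "shift a \<in> measurable env_borel env_borel"
    by (rule measurable_shift)
  show "(\<lambda>\<omega>. F \<omega> * (p \<omega> * G (shift a \<omega>)) :: real) \<in> borel_measurable env_borel"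
    by measurable
  obtain BF BG Bp where "\<forall>y\<in>F ` env_space. norm y \<le> BF" "\<forall>y\<in>G ` env_space. norm y \<le> BG"
      "\<forall>y\<in>p ` env_space. norm y \<le> Bp"
    using assms(4-6) unfolding bounded_iff by blast
  then have B: "\<bar>F \<omega>\<bar> \<le> BF" "\<bar>G \<omega>\<bar> \<le> BG" "\<bar>p \<omega>\<bar> \<le> Bp" if "\<omega> \<in> env_space" for \<omega>
    using that by auto
  show "bounded ((\<lambda>\<omega>. F \<omega> * (p \<omega> * G (shift a \<omega>))) ` env_space)"
  proof (rule boundedI[of _ "BF * (Bp * BG)"], safe)
    fix \<omega> :: "int \<Rightarrow> real" assume \<omega>: "\<omega> \<in> env_space"
    have "\<bar>F \<omega>\<bar> * (\<bar>p \<omega>\<bar> * \<bar>G (shift a \<omega>)\<bar>) \<le> BF * (Bp * BG)"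
      using B(1,3)[OF \<omega>] B(2)[OF shift_in_env_space[OF \<omega>, of a]]
      by (intro mult_mono mult_nonneg_nonneg) auto
    then show "norm (F \<omega> * (p \<omega> * G (shift a \<omega>))) \<le> BF * (Bp * BG)"
      by (simp add: abs_mult)
  qed
qed

lemma coordinate_measurable_bounded:
  shows "(\<lambda>\<omega>. \<omega> x) \<in> borel_measurable env_borel" "(\<lambda>\<omega>. 1 - \<omega> x) \<in> borel_measurable env_borel"
    and "bounded ((\<lambda>\<omega>. \<omega> x) ` env_space)" "bounded ((\<lambda>\<omega>. 1 - \<omega> x) ` env_space)"
proof -
  show "(\<lambda>\<omega>. \<omega> x) \<in> borel_measurable env_borel"
    by (rule continuous_map_measurable_env_borel[OF continuous_map_coordinate])
  then show "(\<lambda>\<omega>. 1 - \<omega> x) \<in> borel_measurable env_borel"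
    by measurable
  show "bounded ((\<lambda>\<omega>. \<omega> x) ` env_space)" "bounded ((\<lambda>\<omega>. 1 - \<omega> x) ` env_space)"
    by (auto intro!: boundedI[of _ 1] simp: env_space_def)
qed

text \<open>Both sides are the sum over \<open>x\<close> of the conductance of the edge from \<open>x\<close> to \<open>x + 1\<close>, integrated
  against \<open>F\<close> seen from \<open>x\<close> and \<open>G\<close> seen from \<open>x + 1\<close>; the particle sits at \<open>x\<close> on the left-hand
  side and at \<open>x + 1\<close> on the right-hand side.\<close>

lemma env_measure_detailed_balance:
  assumes Q: "is_env_measure L Q"
    and F: "F \<in> borel_measurable env_borel" "bounded (F ` env_space)"
    and G: "G \<in> borel_measurable env_borel" "bounded (G ` env_space)"
  shows "(\<integral>\<omega>. F \<omega> * (\<omega> 0 * G (shift 1 \<omega>)) \<partial>Q) = (\<integral>\<omega>. G \<omega> * ((1 - \<omega> 0) * F (shift (-1) \<omega>)) \<partial>Q)"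
proof -
  define f where "f x = (\<integral>v. exp (- v x) / (2 * (\<Sum>\<^sub>\<infinity>z. exp (- v z))) *
      (F (shift x (tilde_env v)) * G (shift (x + 1) (tilde_env v))) \<partial>L)" for x
  have shift_shift: "shift a (shift b \<omega>) = shift (b + a) \<omega>" for a b \<omega>
    by (simp add: shift_def add.assoc)
  have shift_0: "shift x \<omega> 0 = \<omega> x" for x \<omega>
    by (simp add: shift_def)
  have right: "tilde_nu v x * (F (shift x (tilde_env v)) *
      (shift x (tilde_env v) 0 * G (shift 1 (shift x (tilde_env v))))) =
      exp (- v x) / (2 * (\<Sum>\<^sub>\<infinity>z. exp (- v z))) *
      (F (shift x (tilde_env v)) * G (shift (x + 1) (tilde_env v)))" for v x
    unfolding tilde_nu_step_right[symmetric] shift_shift shift_0 by (simp only: ac_simps)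
  have left: "tilde_nu v (x + 1) * (G (shift (x + 1) (tilde_env v)) *
      ((1 - shift (x + 1) (tilde_env v) 0) * F (shift (-1) (shift (x + 1) (tilde_env v))))) =
      exp (- v x) / (2 * (\<Sum>\<^sub>\<infinity>z. exp (- v z))) *
      (F (shift x (tilde_env v)) * G (shift (x + 1) (tilde_env v)))" for v x
  proof -
    have "x + 1 + - 1 = x"
      by simp
    then show ?thesis
      unfolding tilde_nu_step_left[symmetric] shift_shift shift_0 by (simp only: ac_simps)
  qed
  have sums: "((\<lambda>x. \<integral>v. tilde_nu v x * H (shift x (tilde_env v)) \<partial>L) has_sum (\<integral>\<omega>. H \<omega> \<partial>Q)) UNIV"
    if "H \<in> borel_measurable env_borel" "bounded (H ` env_space)" for H
    using Q that by (auto simp: is_env_measure_def)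
  have "(f has_sum (\<integral>\<omega>. F \<omega> * (\<omega> 0 * G (shift 1 \<omega>)) \<partial>Q)) UNIV"
    using sums[OF step_measurable_bounded[OF F(1) G(1) coordinate_measurable_bounded(1)
          F(2) G(2) coordinate_measurable_bounded(3)], of 0 1]
    unfolding right f_def[symmetric] by simp
  moreover have "(f has_sum (\<integral>\<omega>. G \<omega> * ((1 - \<omega> 0) * F (shift (-1) \<omega>)) \<partial>Q)) UNIV"
  proof -
    have bij: "bij_betw (\<lambda>x. x + 1) UNIV (UNIV :: int set)"
      by (rule bij_betwI[of _ _ _ "\<lambda>x. x - 1"]) auto
    show ?thesis
      using iffD2[OF has_sum_reindex_bij_betw[OF bij]
          sums[OF step_measurable_bounded[OF G(1) F(1) coordinate_measurable_bounded(2)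
            G(2) F(2) coordinate_measurable_bounded(4)], of 0 "-1"]]
      unfolding left f_def[symmetric] .
  qed
  ultimately show ?thesis
    by (rule has_sum_unique)
qed

lemma env_measure_reversible:
  assumes Q: "is_env_measure L Q"
  shows "reversible Q"
  unfolding reversible_def
proof (intro allI impI)
  fix F G assume "bounded_continuous F" "bounded_continuous G"
  then have F: "F \<in> borel_measurable env_borel" "bounded (F ` env_space)"
    and G: "G \<in> borel_measurable env_borel" "bounded (G ` env_space)"
    by (auto simp: bounded_continuous_def continuous_map_measurable_env_borel)
  have sets: "sets Q = sets env_borel" and prob: "prob_space Q"
    using Q by (auto simp: is_env_measure_def)
  interpret prob_space Q by (rule prob)
  have space: "space Q = env_space"
    using sets_eq_imp_space_eq[OF sets] by simp
  have integrable: "integrable Q H" if H: "H \<in> borel_measurable env_borel" "bounded (H ` env_space)"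
    for H :: "(int \<Rightarrow> real) \<Rightarrow> real"
  proof -
    obtain B where "\<And>\<omega>. \<omega> \<in> env_space \<Longrightarrow> norm (H \<omega>) \<le> B"
      using H(2) unfolding bounded_iff by auto
    then show ?thesis
      using H(1) by (intro integrable_const_bound[of _ B]) (auto simp: space measurable_cong_sets[OF sets refl])
  qed
  have split: "(\<integral>\<omega>. A \<omega> * kernel_op B \<omega> \<partial>Q) =
      (\<integral>\<omega>. A \<omega> * (\<omega> 0 * B (shift 1 \<omega>)) \<partial>Q) + (\<integral>\<omega>. A \<omega> * ((1 - \<omega> 0) * B (shift (-1) \<omega>)) \<partial>Q)"
    if A: "A \<in> borel_measurable env_borel" "bounded (A ` env_space)"
      and B: "B \<in> borel_measurable env_borel" "bounded (B ` env_space)" for A B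
  proof -
    have "(\<integral>\<omega>. A \<omega> * kernel_op B \<omega> \<partial>Q) =
        (\<integral>\<omega>. A \<omega> * (\<omega> 0 * B (shift 1 \<omega>)) + A \<omega> * ((1 - \<omega> 0) * B (shift (-1) \<omega>)) \<partial>Q)"
      by (intro Bochner_Integration.integral_cong refl)
        (simp add: space integral_env_kernel[OF _ B(1)] distrib_left)
    also have "\<dots> = (\<integral>\<omega>. A \<omega> * (\<omega> 0 * B (shift 1 \<omega>)) \<partial>Q) +
        (\<integral>\<omega>. A \<omega> * ((1 - \<omega> 0) * B (shift (-1) \<omega>)) \<partial>Q)"
      by (intro Bochner_Integration.integral_add integrable step_measurable_bounded A B
          coordinate_measurable_bounded)
    finally show ?thesis .
  qed
  show "(\<integral>\<omega>. F \<omega> * kernel_op G \<omega> \<partial>Q) = (\<integral>\<omega>. G \<omega> * kernel_op F \<omega> \<partial>Q)"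
    unfolding split[OF F G] split[OF G F] env_measure_detailed_balance[OF Q F G]
      env_measure_detailed_balance[OF Q G F] by simp
qed

text \<open>Reversibility against the constant function \<open>1\<close>, which the kernel preserves.\<close>

lemma reversible_imp_invariant:
  assumes "reversible Q" and sets: "sets Q = sets env_borel"
  shows "invariant Q"
  unfolding invariant_def
proof (intro allI impI)
  fix F assume F: "bounded_continuous F"
  have one: "bounded_continuous (\<lambda>_. 1)"
    by (auto simp: bounded_continuous_def intro: boundedI[of _ 1])
  have "(\<integral>\<omega>. kernel_op F \<omega> \<partial>Q) = (\<integral>\<omega>. F \<omega> * kernel_op (\<lambda>_. 1) \<omega> \<partial>Q)"
    using assms(1) F one unfolding reversible_def by fastforce
  also have "\<dots> = (\<integral>\<omega>. F \<omega> \<partial>Q)"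
  proof (intro Bochner_Integration.integral_cong refl)
    fix \<omega> assume "\<omega> \<in> space Q"
    then have "\<omega> \<in> env_space"
      using sets_eq_imp_space_eq[OF sets] by simp
    then show "F \<omega> * kernel_op (\<lambda>_. 1) \<omega> = F \<omega>"
      by (simp add: integral_env_kernel)
  qed
  finally show "(\<integral>\<omega>. kernel_op F \<omega> \<partial>Q) = (\<integral>\<omega>. F \<omega> \<partial>Q)" .
qed

section \<open>Invariance, reversibility and singularity\<close>

theorem proposition1p2:
  fixes P L Q :: "(int \<Rightarrow> real) measure"
  assumes "prob_space P" and "sets P = sets env_borel"
    and iid: "prob_space.indep_vars P (\<lambda>_. borel) (\<lambda>x \<omega>. \<omega> x) UNIV"
      "\<forall>x. distr P borel (\<lambda>\<omega>. \<omega> x) = distr P borel (\<lambda>\<omega>. \<omega> 0)"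
    and A1: "(\<integral>\<omega>. ln (rho \<omega> 0) \<partial>P) = 0"
    and A2: "\<exists>\<delta>\<^sub>0. 0 < \<delta>\<^sub>0 \<and> \<delta>\<^sub>0 < 1 \<and> \<P>(\<omega> in P. \<delta>\<^sub>0 \<le> \<omega> 0 \<and> \<omega> 0 \<le> 1 - \<delta>\<^sub>0) = 1"
    and Var: "prob_space.variance P (\<lambda>\<omega>. ln (rho \<omega> 0)) > 0"
    and L: "is_conditioned_potential_law P L"
    and Q: "is_env_measure L Q"
  shows "invariant Q \<and> reversible Q \<and> mutually_singular P Q"
proof (intro conjI)
  have sets_Q: "sets Q = sets env_borel"
    using Q by (auto simp: is_env_measure_def)
  show "reversible Q"
    by (rule env_measure_reversible[OF Q])
  then show "invariant Q"
    using sets_Q by (rule reversible_imp_invariant)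
  have "escaping \<in> sets P" and "emeasure P escaping = 0"
    using prob_escaping_eq_0[OF assms(1,2) iid] by auto
  moreover have "sets P = sets Q"
    by (simp add: assms(2) sets_Q)
  moreover from calculation have "emeasure Q (space Q - escaping) = 0"
    by (intro env_measure_not_escaping_eq_0[OF Q]) simp
  ultimately show "mutually_singular P Q"
    unfolding mutually_singular_def by blast
qed

end
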